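(* For odd $k$ let $\mathrm{Ex}^{(k+1)/2}_k=f_{\{(k+1)/2\},k}:\{-1,1\}^k\to\{0,1\}$ be the function which is $1$ exactly on vectors with exactly $\frac{k+1}2$ coordinates equal to $1$. Then for every odd $k\in\{3,\ldots,51\}$, $$\alpha\big(\mathrm{Ex}^{(k+1)/2}_k\big)=\binom{k}{\frac{k+1}2}\left(\frac{k-1}{2k}(1-p'_k)^{(k+1)/2}(p'_k)^{(k-1)/2}+\frac{k+1}{2k}(1-p'_k)^{(k-1)/2}(p'_k)^{(k+1)/2}\right),$$ where $p'_k=\frac{3k-k^2+\sqrt{4k+k^2-2k^3+k^4}}{4k}$.
   Context: For $\mathbf b\in\{-1,1\}^k$, $\mathrm{wt}(\mathbf b)$ is the number of coordinates equal to $1$. For nonempty $S\subseteq[k]=\{1,\dots,k\}$, $f_{S,k}:\{-1,1\}^k\to\{0,1\}$ is given by $f_{S,k}(\mathbf x)=1$ iff $\mathrm{wt}(\mathbf x)\in S$. $\Delta_k$ is the set of symmetric probability distributions $\mathcal D$ on $\{-1,1\}^k$ (vectors of equal weight are equiprobable). $\mathrm{Bern}(p)$ is the random variable equal to $1$ with probability $p$ and $-1$ with probability $1-p$; $\odot$ is the coordinatewise product. For $\mathcal D\in\Delta_k$ and $p\in[0,1]$ define $$\lambda_S(\mathcal D,p)=\mathbb E_{\mathbf a\sim\mathcal D,\ \mathbf b\sim \mathrm{Bern}(p)^k}[f_{S,k}(\mathbf a\odot\mathbf b)],\quad \mu(\mathcal D)=\mathbb E_{\mathbf b\sim\mathcal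 D}[b_1],\quad \beta_S(\mathcal D)=\sup_{p\in[0,1]}\lambda_S(\mathcal D,p),\quad \gamma_S(\mathcal D)=\lambda_S(\mathcal D,1).$$ The (sketching approximation) ratio of $f_{S,k}$ is $$\alpha(f_{S,k})=\inf_{\mathcal D_N,\mathcal D_Y\in\Delta_k:\ \mu(\mathcal D_N)=\mu(\mathcal D_Y)}\frac{\beta_S(\mathcal D_N)}{\gamma_S(\mathcal D_Y)},$$ where the ratio is $+\infty$ if $\gamma_S(\mathcal D_Y)=0$. *)

theory Defs
  imports "HOL-Probability.Probability"
begin

text \<open>
  Vectors in \<open>{-1,1}\<^sup>k\<close> are functions on the index set \<open>{1..k}\<close> that are
  \<open>undefined\<close> outside of it, so that distinct functions are distinct vectors.
\<close>

definition cube :: "nat \<Rightarrow> (nat \<Rightarrow> int) set" where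
  "cube k = {1..k} \<rightarrow>\<^sub>E {-1, 1}"

definition wt :: "nat \<Rightarrow> (nat \<Rightarrow> int) \<Rightarrow> nat" where
  "wt k x = card {i \<in> {1..k}. x i = 1}"

definition sym_fun :: "nat set \<Rightarrow> nat \<Rightarrow> (nat \<Rightarrow> int) \<Rightarrow> real" where
  "sym_fun S k x = (if wt k x \<in> S then 1 else 0)"

definition sym_dists :: "nat \<Rightarrow> (nat \<Rightarrow> int) pmf set" where
  "sym_dists k = {D. set_pmf D \<subseteq> cube k \<and>
     (\<forall>x\<in>cube k. \<forall>y\<in>cube k. wt k x = wt k y \<longrightarrow> pmf D x = pmf D y)}"

definition Bern :: "real \<Rightarrow> int pmf" where
  "Bern p = map_pmf (\<lambda>b. if b then 1 else -1) (bernoulli_pmf p)"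

text \<open>The default value \<open>undefined\<close> makes the product distribution live on \<^const>\<open>cube\<close>.\<close>

definition Bern_power :: "nat \<Rightarrow> real \<Rightarrow> (nat \<Rightarrow> int) pmf" where
  "Bern_power k p = Pi_pmf {1..k} undefined (\<lambda>_. Bern p)"

definition cw_prod :: "nat \<Rightarrow> (nat \<Rightarrow> int) \<Rightarrow> (nat \<Rightarrow> int) \<Rightarrow> nat \<Rightarrow> int" where
  "cw_prod k a b = (\<lambda>i\<in>{1..k}. a i * b i)"

definition lam :: "nat set \<Rightarrow> nat \<Rightarrow> (nat \<Rightarrow> int) pmf \<Rightarrow> real \<Rightarrow> real" where
  "lam S k D p = measure_pmf.expectation (pair_pmf D (Bern_power k p))
     (\<lambda>(a, b). sym_fun S k (cw_prod k a b))"

definition mu :: "(nat \<Rightarrow> int) pmf \<Rightarrow> real" where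
  "mu D = measure_pmf.expectation D (\<lambda>b. real_of_int (b 1))"

definition beta :: "nat set \<Rightarrow> nat \<Rightarrow> (nat \<Rightarrow> int) pmf \<Rightarrow> real" where
  "beta S k D = (SUP p\<in>{0..1}. lam S k D p)"

definition gamma :: "nat set \<Rightarrow> nat \<Rightarrow> (nat \<Rightarrow> int) pmf \<Rightarrow> real" where
  "gamma S k D = lam S k D 1"

text \<open>
  The ratio of \<open>sym_fun S k\<close>; it is given by the pair \<open>(S, k)\<close>. The infimum is taken in the
  extended reals, where division of reals by zero must be redirected to \<open>\<infinity>\<close> explicitly.
\<close>

definition alpha :: "nat set \<Rightarrow> nat \<Rightarrow> ereal" where
  "alpha S k = (INF (DN, DY)\<in>{(DN, DY). DN \<in> sym_dists k \<and> DY \<in> sym_dists k \<and> mu DN = mu DY}.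
     if gamma S k DY = 0 then \<infinity> else ereal (beta S k DN / gamma S k DY))"

end

theory Submission
  imports Defs "HOL-Computational_Algebra.Polynomial"
begin

text \<open>
  Write \<open>k = 2 * n + 1\<close>. The infimum is attained when \<open>DY\<close> is uniform on the vectors of weight
  \<open>n + 1\<close> and \<open>DN\<close> is the mixture of the two constant vectors with the same mean \<open>1 / k\<close>; the
  supremum over the bias is then a one-variable maximum, attained at \<open>p'\<close>.

  For the lower bound it suffices to evaluate \<^const>\<open>lam\<close> at the single bias \<open>p'\<close>. As a function of
  the weight \<open>i\<close> of the first vector, the probability of obtaining weight \<open>n + 1\<close> lies above its
  chord between \<open>0\<close> and \<open>k\<close>, because it is concave in \<open>i\<close>: its second difference is
  \<open>(2 * p' - 1)\<^sup>2\<close> times a central second difference of the weight distribution on \<open>k - 2\<close>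
  coordinates. A three-term recurrence for that distribution, together with its log-concavity, shows
  that the latter is negative as soon as \<open>n * (2 * p' - 1)\<close> is small, and indeed
  \<open>2 * p' - 1 \<le> 1 / (k * (k - 1))\<close>.
\<close>

subsection \<open>Coefficients of products of two kinds of linear factors\<close>

text \<open>
  If \<open>y\<close> has independent \<open>Bern p\<close> entries and \<open>x\<close> has weight \<open>a\<close> among \<open>a + b\<close> coordinates,
  this is the generating polynomial of the weight of the coordinatewise product.
\<close>

definition bpoly :: "real \<Rightarrow> nat \<Rightarrow> nat \<Rightarrow> real poly" where
  "bpoly p a b = [:1 - p, p:] ^ a * [:p, 1 - p:] ^ b"

lemma bpoly_Suc1: "bpoly p (Suc a) b = [:1 - p, p:] * bpoly p a b"
  and bpoly_Suc2: "bpoly p a (Suc b) = [:p, 1 - p:] * bpoly p a b"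
  by (simp_all only: bpoly_def power_Suc mult_ac)

lemma coeff_linear_mult:
  fixes c d :: "'a :: comm_semiring_0"
  shows "coeff ([:c, d:] * g) 0 = c * coeff g 0"
    and "coeff ([:c, d:] * g) (Suc j) = c * coeff g (Suc j) + d * coeff g j"
  by (simp_all add: mult_pCons_left)

text \<open>The inequality is demanded for all pairs \<open>i \<le> j\<close>, not only for
  neighbours: this excludes internal zeros and is stable under multiplication by a linear
  factor.\<close>

definition log_concave :: "real poly \<Rightarrow> bool" where
  "log_concave g \<longleftrightarrow> (\<forall>j. 0 \<le> coeff g j) \<and>
     (\<forall>i j. i \<le> j \<longrightarrow> coeff g i * coeff g (Suc j) \<le> coeff g (Suc i) * coeff g j)"

text \<open>Expanded in \<open>c\<close> and \<open>d\<close>, the difference of the two sides has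
  nonnegative coefficients at \<open>c\<^sup>2\<close>, \<open>c * d\<close> and
  \<open>d\<^sup>2\<close>. The index \<open>i = 0\<close> is treated apart, as no coefficient lies
  below it.\<close>

lemma log_concave_linear_mult:
  assumes g: "log_concave g" and c: "0 \<le> c" and d: "0 \<le> d"
  shows "log_concave ([:c, d:] * g)"
proof -
  let ?h = "[:c, d:] * g"
  define G where "G j = coeff g j" for j
  have pos: "0 \<le> G j" for j
    using g by (simp add: log_concave_def G_def)
  have lc: "G i * G (Suc j) \<le> G (Suc i) * G j" if "i \<le> j" for i j
    using g that by (simp add: log_concave_def G_def)
  have h0: "coeff ?h 0 = c * G 0"
    by (simp only: coeff_linear_mult G_def)
  have hS: "coeff ?h (Suc j) = c * G (Suc j) + d * G j" for j
    by (simp only: coeff_linear_mult G_def)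
  have "0 \<le> coeff ?h j" for j
    by (cases j) (simp_all only: h0 hS add_nonneg_nonneg mult_nonneg_nonneg c d pos)
  moreover have "coeff ?h i * coeff ?h (Suc j) \<le> coeff ?h (Suc i) * coeff ?h j"
    if ij: "i \<le> j" for i j
  proof (cases i)
    case i0: 0
    show ?thesis
    proof (cases j)
      case 0
      then show ?thesis using i0 by (simp only: mult.commute)
    next
      case (Suc l)
      have "0 \<le> c\<^sup>2 * (G 1 * G (Suc l) - G 0 * G (Suc (Suc l))) + c * d * (G 1 * G l)
          + d\<^sup>2 * (G 0 * G l)"
        using lc[of 0 "Suc l"] pos c d by (intro add_nonneg_nonneg mult_nonneg_nonneg) auto
      then show ?thesis
        unfolding i0 Suc h0 hS by (simp add: algebra_simps power2_eq_square)
    qed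
  next
    case (Suc r)
    then obtain l where l: "j = Suc l" and rl: "r \<le> l"
      using ij by (cases j) auto
    \<comment> \<open>The mixed term compares indices two apart: for \<open>r < l\<close> the
      inequality \<open>lc\<close> is applied twice in a chain, and for \<open>r = l\<close> the two
      products agree.\<close>
    have "0 \<le> G (Suc (Suc r)) * G l - G r * G (Suc (Suc l))"
    proof (cases "r = l")
      case False
      then have "G (Suc r) * G (Suc l) \<le> G (Suc (Suc r)) * G l"
        using rl lc[of "Suc r" l] by simp
      moreover have "G r * G (Suc (Suc l)) \<le> G (Suc r) * G (Suc l)"
        using rl lc[of r "Suc l"] by simp
      ultimately show ?thesis by simp
    qed (simp add: mult.commute)
    then have "0 \<le> c\<^sup>2 * (G (Suc (Suc r)) * G (Suc l) - G (Suc r) * G (Suc (Suc l)))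
        + c * d * (G (Suc (Suc r)) * G l - G r * G (Suc (Suc l)))
        + d\<^sup>2 * (G (Suc r) * G l - G r * G (Suc l))"
      using lc[of "Suc r" "Suc l"] lc[of r l] rl c d
      by (intro add_nonneg_nonneg mult_nonneg_nonneg) auto
    then show ?thesis
      unfolding Suc l hS by (simp add: algebra_simps power2_eq_square)
  qed
  ultimately show ?thesis
    unfolding log_concave_def by blast
qed

lemma log_concave_bpoly:
  assumes "0 \<le> p" "p \<le> 1"
  shows "log_concave (bpoly p a b)"
proof (induction a)
  case 0
  show ?case
  proof (induction b)
    case 0
    show ?case by (simp add: log_concave_def bpoly_def)
  next
    case (Suc b)
    then show ?case unfolding bpoly_Suc2 using assms by (intro log_concave_linear_mult) auto
  qed
next
  case (Suc a)
  then show ?case unfolding bpoly_Suc1 using assms by (intro log_concave_linear_mult) auto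
qed

lemma coeff_linear_mult_pos:
  fixes g :: "real poly"
  assumes "\<And>j. j \<le> N \<Longrightarrow> 0 < coeff g j" "\<And>j. 0 \<le> coeff g j" "0 < c" "0 < d" "j \<le> Suc N"
  shows "0 < coeff ([:c, d:] * g) j"
proof (cases j)
  case 0
  then show ?thesis using assms by (simp only: coeff_linear_mult mult_pos_pos)
next
  case (Suc i)
  then have "0 < d * coeff g i" "0 \<le> c * coeff g (Suc i)"
    using assms by auto
  then show ?thesis unfolding Suc coeff_linear_mult by simp
qed

lemma coeff_bpoly_nonneg:
  assumes "0 \<le> p" "p \<le> 1"
  shows "0 \<le> coeff (bpoly p a b) j"
  using log_concave_bpoly[OF assms] by (simp add: log_concave_def)

text \<open>Strict positivity permits cancelling a coefficient when ratios are compared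
  below.\<close>

lemma coeff_bpoly_pos:
  assumes p: "0 < p" "p < 1" and "j \<le> a + b"
  shows "0 < coeff (bpoly p a b) j"
  using \<open>j \<le> a + b\<close>
proof (induction a arbitrary: j)
  case 0
  then show ?case
  proof (induction b arbitrary: j)
    case 0
    then show ?case by (simp add: bpoly_def)
  next
    case (Suc b)
    show ?case unfolding bpoly_Suc2
      by (rule coeff_linear_mult_pos[of b]) (use p Suc in \<open>auto intro: coeff_bpoly_nonneg\<close>)
  qed
next
  case (Suc a)
  show ?case unfolding bpoly_Suc1
    by (rule coeff_linear_mult_pos[of "a + b"]) (use p Suc in \<open>auto intro: coeff_bpoly_nonneg\<close>)
qed

lemma coeff_linear_power:
  fixes c d :: real
  shows "coeff ([:c, d:] ^ N) j = real (N choose j) * c ^ (N - j) * d ^ j"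
proof (induction N arbitrary: j)
  case 0
  then show ?case by (cases j) auto
next
  case (Suc N)
  show ?case
  proof (cases j)
    case 0
    then show ?thesis using Suc by (simp only: power_Suc coeff_linear_mult) simp
  next
    case (Suc i)
    show ?thesis
    proof (cases "i < N")
      case True
      then have "c ^ (N - i) = c * c ^ (N - Suc i)"
        by (metis Suc_diff_Suc power_Suc)
      then show ?thesis
        unfolding Suc power_Suc coeff_linear_mult Suc.IH by (simp add: algebra_simps)
    next
      case False
      then show ?thesis
        unfolding Suc power_Suc coeff_linear_mult Suc.IH by (auto simp: algebra_simps)
    qed
  qed
qed

text \<open>
  Equality holds for \<open>a = 0\<close>. By log-concavity, the ratio of the two middle coefficients can only
  grow when a factor \<open>[:p, 1 - p:]\<close> is replaced by \<open>[:1 - p, p:]\<close>.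
\<close>

lemma coeff_bpoly_middle_ratio:
  assumes p: "1 / 2 \<le> p" "p < 1"
  shows "a + b = Suc (2 * l) \<Longrightarrow>
    (1 - p) * coeff (bpoly p a b) l \<le> p * coeff (bpoly p a b) (Suc l)"
proof (induction a arbitrary: b)
  case 0
  have "Suc (2 * l) choose l = Suc (2 * l) choose Suc l"
    by (rule binomial_symmetric[of l "Suc (2 * l)", simplified, THEN trans]) (simp add: Suc_diff_le)
  moreover have "coeff (bpoly p 0 b) j = real (b choose j) * p ^ (b - j) * (1 - p) ^ j" for j
    by (simp only: bpoly_def power_0 mult_1_left coeff_linear_power)
  moreover have b: "b = Suc (2 * l)" and "b - l = Suc l" "b - Suc l = l"
    using 0 by auto
  ultimately have "coeff (bpoly p 0 b) l = real (b choose l) * p ^ Suc l * (1 - p) ^ l"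
    "coeff (bpoly p 0 b) (Suc l) = real (b choose l) * p ^ l * (1 - p) ^ Suc l"
    by (simp_all only:)
  then show ?case by (simp only: power_Suc mult_ac order_refl)
next
  case (Suc a)
  let ?q = "1 - p"
  define g where "g = coeff (bpoly p a b)"
  let ?yA = "?q * g (Suc l) + p * g l" and ?yB = "p * g (Suc l) + ?q * g l"
  have lg: "log_concave (bpoly p a b)"
    using p by (intro log_concave_bpoly) auto
  define wA where "wA = coeff (bpoly p (Suc a) b) l"
  define wB where "wB = coeff (bpoly p a (Suc b)) l"
  have yA: "coeff (bpoly p (Suc a) b) (Suc l) = ?yA"
    and yB: "coeff (bpoly p a (Suc b)) (Suc l) = ?yB"
    by (simp_all only: bpoly_Suc1 bpoly_Suc2 coeff_linear_mult g_def)
  have wB_pos: "0 < wB" and wA_pos: "0 \<le> wA"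
    using p Suc.prems by (auto simp: wA_def wB_def intro!: coeff_bpoly_pos coeff_bpoly_nonneg)
  have IH: "?q * wB \<le> p * ?yB"
    using Suc.IH[of "Suc b"] Suc.prems unfolding wB_def yB by simp
  \<comment> \<open>This is \<open>wA / wB \<le> ?yA / ?yB\<close> without division. Both
    polynomials share the factor \<open>bpoly p a b\<close>, so the difference is
    \<open>2 * p - 1\<close> times a log-concavity difference of \<open>g\<close>; for
    \<open>l = 0\<close> the lower coefficient is absent.\<close>
  have cross: "wA * ?yB \<le> ?yA * wB"
  proof (cases l)
    case 0
    have w: "wA = ?q * g 0" "wB = p * g 0"
      unfolding 0 wA_def wB_def by (simp_all only: bpoly_Suc1 bpoly_Suc2 coeff_linear_mult g_def)
    have "0 \<le> (2 * p - 1) * (g 0)\<^sup>2"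
      using p by simp
    also have "\<dots> = ?yA * wB - wA * ?yB"
      unfolding w 0 by (simp add: algebra_simps power2_eq_square)
    finally show ?thesis by simp
  next
    case (Suc r)
    have w: "wA = ?q * g l + p * g r" "wB = p * g l + ?q * g r"
      unfolding Suc wA_def wB_def by (simp_all only: bpoly_Suc1 bpoly_Suc2 coeff_linear_mult g_def)
    have "g r * g (Suc l) \<le> g l * g l"
      using lg unfolding Suc log_concave_def g_def by auto
    then have "0 \<le> (2 * p - 1) * (g l * g l - g r * g (Suc l))"
      using p by (intro mult_nonneg_nonneg) auto
    also have "\<dots> = ?yA * wB - wA * ?yB"
      unfolding w by (simp add: algebra_simps power2_eq_square)
    finally show ?thesis by simp
  qed
  have "(?q * wA) * wB \<le> wA * (p * ?yB)"
    using mult_left_mono[OF IH wA_pos] by (simp add: mult_ac)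
  also have "\<dots> \<le> (p * ?yA) * wB"
    using mult_left_mono[OF cross, of p] p by (simp add: mult_ac)
  finally show ?case
    using wB_pos unfolding yA wA_def[symmetric] by simp
qed

section \<open>Differential equation and three-term recurrence for the coefficients\<close>

lemma pderiv_linear_power:
  fixes c d :: real
  shows "[:c, d:] * pderiv ([:c, d:] ^ a) = smult (real a * d) ([:c, d:] ^ a)"
  by (cases a) (simp_all only: pderiv_power_Suc, simp_all add: pderiv_pCons algebra_simps)

text \<open>The logarithmic derivative of the product with denominators cleared; multiplying each
  derivative by its base keeps the exponents \<open>a\<close> and \<open>b\<close> intact, also when
  they are zero.\<close>

lemma pderiv_bpoly:
  "[:1 - p, p:] * [:p, 1 - p:] * pderiv (bpoly p a b)
     = (smult (real a * p) [:p, 1 - p:] + smult (real b * (1 - p)) [:1 - p, p:]) * bpoly p a b"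
proof -
  let ?A = "[:1 - p, p:]" and ?B = "[:p, 1 - p:]"
  have "?A * ?B * pderiv (bpoly p a b)
      = ?B * ?B ^ b * (?A * pderiv (?A ^ a)) + ?A * ?A ^ a * (?B * pderiv (?B ^ b))"
    unfolding bpoly_def pderiv_mult by (simp only: algebra_simps)
  also have "\<dots> = (smult (real a * p) ?B + smult (real b * (1 - p)) ?A) * (?A ^ a * ?B ^ b)"
    unfolding pderiv_linear_power
    by (simp only: ring_distribs mult_smult_left mult_smult_right mult_ac)
  finally show ?thesis unfolding bpoly_def .
qed

text \<open>Comparison of the coefficients at \<open>j + 1\<close> in the differential equation,
  where the product of the two linear factors is
  \<open>[:p * q, p\<^sup>2 + q\<^sup>2, p * q:]\<close>.\<close>

lemma coeff_bpoly_recurrence: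
  fixes p :: real
  defines "q \<equiv> 1 - p"
  shows "p * q * real (j + 2) * coeff (bpoly p a b) (j + 2)
    = (real a * p\<^sup>2 + real b * q\<^sup>2 - (p\<^sup>2 + q\<^sup>2) * real (j + 1)) * coeff (bpoly p a b) (j + 1)
      + p * q * (real a + real b - real j) * coeff (bpoly p a b) j"
proof -
  let ?F = "bpoly p a b"
  have "coeff ([:q, p:] * ([:p, q:] * pderiv ?F)) (Suc j) =
      coeff ((smult (real a * p) [:p, q:] + smult (real b * q) [:q, p:]) * ?F) (Suc j)"
    using arg_cong[OF pderiv_bpoly[of p a b], of "\<lambda>g. coeff g (Suc j)"]
    unfolding q_def mult.assoc .
  moreover have "smult (real a * p) [:p, q:] + smult (real b * q) [:q, p:]
      = [:real a * p\<^sup>2 + real b * q\<^sup>2, (real a + real b) * (p * q):]"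
    by (simp add: power2_eq_square algebra_simps)
  moreover have "coeff ([:q, p:] * ([:p, q:] * pderiv ?F)) (Suc j) =
     p * q * real (j + 2) * coeff ?F (j + 2) + (p\<^sup>2 + q\<^sup>2) * real (j + 1) * coeff ?F (j + 1)
      + p * q * real j * coeff ?F j"
    by (cases j) (simp_all only: coeff_linear_mult coeff_pderiv,
      simp_all add: algebra_simps power2_eq_square)
  ultimately show ?thesis
    by (simp only: coeff_linear_mult) (simp add: algebra_simps)
qed

subsection \<open>Concavity in the weight and the optimal bias\<close>

text \<open>The recurrence eliminates coefficient \<open>l + 2\<close> and the ratio bound dominates
  coefficient \<open>l\<close>; what remains is coefficient \<open>l + 1\<close> times a number that
  \<open>small\<close> makes nonpositive.\<close>

lemma coeff_bpoly_concave_middle: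
  assumes ab: "a + b = Suc (2 * l)"
    and p: "1 / 2 \<le> p" "p < 1"
    and small: "8 * real (Suc l) * (2 * p - 1) + (4 * real (Suc l) + 2) * (2 * p - 1)\<^sup>2 \<le> 2"
  shows "coeff (bpoly p a b) (l + 2) - 2 * coeff (bpoly p a b) (l + 1) + coeff (bpoly p a b) l \<le> 0"
proof -
  define q where "q = 1 - p"
  define n where "n = real (Suc l)"
  define x where "x = coeff (bpoly p a b) (l + 2)"
  define y where "y = coeff (bpoly p a b) (l + 1)"
  define w where "w = coeff (bpoly p a b) l"
  have b: "real b = 2 * n - 1 - real a"
    using arg_cong[OF ab, of real] by (simp add: n_def)
  have q: "0 < q" and p0: "0 < p"
    using p by (auto simp: q_def)
  have y: "0 \<le> y"
    using p unfolding y_def by (intro coeff_bpoly_nonneg) auto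
  have ratio: "q * w \<le> p * y"
    using coeff_bpoly_middle_ratio[OF p ab] by (simp add: q_def w_def y_def)
  define c where "c = real a * p\<^sup>2 + real b * q\<^sup>2 - (p\<^sup>2 + q\<^sup>2) * n"
  have rec: "p * q * (n + 1) * x = c * y + p * q * n * w"
    using coeff_bpoly_recurrence[of p l a b]
    unfolding x_def y_def w_def q_def[symmetric] c_def b by (simp add: n_def algebra_simps)
  have "c = real a * (2 * p - 1) - n * p\<^sup>2 + (n - 1) * q\<^sup>2"
    unfolding c_def b q_def by (simp add: algebra_simps power2_eq_square)
  \<comment> \<open>Since \<open>p\<^sup>2 - q\<^sup>2 = 2 * p - 1\<close> is nonnegative,
    \<open>c\<close> increases with \<open>a\<close>, so the worst case is
    \<open>b = 0\<close>.\<close>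
  also have "\<dots> \<le> (2 * n - 1) * (2 * p - 1) - n * p\<^sup>2 + (n - 1) * q\<^sup>2"
    using p b by (intro add_right_mono diff_right_mono mult_right_mono) auto
  finally have c: "c \<le> (2 * n - 1) * (2 * p - 1) - n * p\<^sup>2 + (n - 1) * q\<^sup>2" .
  \<comment> \<open>The factor 4 clears denominators once \<open>p\<close> and \<open>q\<close> are
    written as \<open>(1 + d) / 2\<close> and \<open>(1 - d) / 2\<close> with
    \<open>d = 2 * p - 1\<close>.\<close>
  have "4 * (c - 2 * (p * q) * (n + 1) + p\<^sup>2 * (2 * n + 1))
      \<le> 4 * ((2 * n - 1) * (2 * p - 1) - n * p\<^sup>2 + (n - 1) * q\<^sup>2
           - 2 * (p * q) * (n + 1) + p\<^sup>2 * (2 * n + 1))"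
    by (intro mult_left_mono add_right_mono diff_right_mono c) simp
  also have "\<dots> = 8 * n * (2 * p - 1) + (4 * n + 2) * (2 * p - 1)\<^sup>2 - 2"
    unfolding q_def by (simp add: algebra_simps power2_eq_square)
  also have "\<dots> \<le> 0"
    using small by (simp add: n_def)
  finally have neg: "c - 2 * (p * q) * (n + 1) + p\<^sup>2 * (2 * n + 1) \<le> 0"
    by simp
  have "p * q * (n + 1) * (x - 2 * y + w)
      = (c - 2 * (p * q) * (n + 1)) * y + p * (2 * n + 1) * (q * w)"
    using rec by (simp add: algebra_simps)
  also have "\<dots> \<le> (c - 2 * (p * q) * (n + 1)) * y + p * (2 * n + 1) * (p * y)"
    using ratio p0 by (intro add_left_mono mult_left_mono) (auto simp: n_def)
  also have "\<dots> = (c - 2 * (p * q) * (n + 1) + p\<^sup>2 * (2 * n + 1)) * y"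
    by (simp add: algebra_simps power2_eq_square)
  also have "\<dots> \<le> 0"
    using neg y by (rule mult_nonpos_nonneg)
  finally show ?thesis
    using p0 q unfolding x_def[symmetric] y_def[symmetric] w_def[symmetric]
    by (simp add: mult_le_0_iff n_def)
qed

text \<open>Subtracting the chord keeps concavity and gives zero at both ends; a negative minimum
  would then be interior and contradict concavity.\<close>

lemma discrete_concave_above_chord:
  fixes L :: "nat \<Rightarrow> real"
  assumes concave: "\<And>i. Suc i < k \<Longrightarrow> L (Suc (Suc i)) - 2 * L (Suc i) + L i \<le> 0"
    and i: "i \<le> k" and k: "0 < k"
  shows "(real k - real i) / real k * L 0 + real i / real k * L k \<le> L i"
proof (rule ccontr)
  define h where "h j = L j - ((real k - real j) / real k * L 0 + real j / real k * L k)" for j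
  have h0: "h 0 = 0" and hk: "h k = 0"
    using k by (auto simp: h_def)
  have h_concave: "h (Suc (Suc j)) - 2 * h (Suc j) + h j \<le> 0" if "Suc j < k" for j
  proof -
    have "h (Suc (Suc j)) - 2 * h (Suc j) + h j = L (Suc (Suc j)) - 2 * L (Suc j) + L j"
      using k unfolding h_def by (simp add: field_simps)
    then show ?thesis using concave[OF that] by simp
  qed
  assume "\<not> ?thesis"
  then have neg: "h i < 0"
    by (simp add: h_def)
  have "Min (h ` {..k}) \<in> h ` {..k}"
    by (intro Min_in) auto
  then obtain r where r: "r \<le> k" "h r = Min (h ` {..k})"
    by (metis (no_types, lifting) atMost_iff imageE)
  then have r_min: "h r \<le> h j" if "j \<le> k" for j
    using that by simp
  \<comment> \<open>The leftmost minimiser is taken so that the left neighbour is strictly larger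
    and the second difference at \<open>s\<close> is strictly positive.\<close>
  define s where "s = (LEAST s. s \<le> k \<and> h s = h r)"
  have s: "s \<le> k" "h s = h r"
    using LeastI[of "\<lambda>s. s \<le> k \<and> h s = h r" r] r by (auto simp: s_def)
  have "h s < 0"
    using neg r_min[OF i] s by simp
  then have "s \<noteq> 0" "s \<noteq> k"
    using h0 hk by (metis less_irrefl)+
  then obtain t where t: "s = Suc t" "Suc t < k"
    using s(1) by (metis not0_implies_Suc le_neq_implies_less)
  have "h t \<noteq> h r"
    using not_less_Least[of t "\<lambda>s. s \<le> k \<and> h s = h r"] t unfolding s_def[symmetric] by simp
  then have "h r < h t" and "h r \<le> h (Suc (Suc t))"
    using r_min[of t] r_min[of "Suc (Suc t)"] t by auto
  then show False
    using h_concave[OF t(2)] s(2) t(1) by simp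
qed

text \<open>The left side is the common factor times the square of the difference of the two linear
  factors, and that difference is \<open>smult (1 - 2 * p) [:1, - 1:]\<close>.\<close>

lemma bpoly_second_difference:
  "bpoly p (i + 2) j - smult 2 (bpoly p (i + 1) (j + 1)) + bpoly p i (j + 2)
    = smult ((2 * p - 1)\<^sup>2) ([:1, - 1:] * ([:1, - 1:] * bpoly p i j))"
proof -
  let ?A = "[:1 - p, p:]" and ?B = "[:p, 1 - p:]"
  have "bpoly p (i + 2) j - smult 2 (bpoly p (i + 1) (j + 1)) + bpoly p i (j + 2)
      = (?A * ?A - smult 2 (?A * ?B) + ?B * ?B) * bpoly p i j"
    unfolding bpoly_def by (simp only: power_add power2_eq_square power_one_right)
      (simp only: algebra_simps mult_smult_left mult_smult_right)
  also have "?A * ?A - smult 2 (?A * ?B) + ?B * ?B = smult ((2 * p - 1)\<^sup>2) ([:1, - 1:] * [:1, - 1:])"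
    by (simp add: algebra_simps power2_eq_square)
  finally show ?thesis
    by (simp only: mult_smult_left mult.assoc)
qed

lemma coeff_bpoly_above_chord:
  assumes p: "1 / 2 \<le> p" "p < 1" and i: "i \<le> k" and k: "k = 2 * n + 1" and n: "0 < n"
    and small: "8 * real n * (2 * p - 1) + (4 * real n + 2) * (2 * p - 1)\<^sup>2 \<le> 2"
  shows "(real k - real i) / real k * coeff (bpoly p 0 k) (n + 1)
      + real i / real k * coeff (bpoly p k 0) (n + 1) \<le> coeff (bpoly p i (k - i)) (n + 1)"
proof -
  obtain l where l: "n = Suc l"
    using n by (cases n) auto
  define L where "L i = coeff (bpoly p i (k - i)) (n + 1)" for i
  have "L (Suc (Suc r)) - 2 * L (Suc r) + L r \<le> 0" if r: "Suc r < k" for r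
  proof -
    define j where "j = k - r - 2"
    have j: "k - Suc (Suc r) = j" "k - Suc r = j + 1" "k - r = j + 2"
      using r by (auto simp: j_def)
    \<comment> \<open>Two coordinates are used up by the second difference; the remaining
      \<open>2 * n - 1\<close> are odd in number, and the coefficient \<open>n + 1 = l + 2\<close>
      meets exactly the indices \<open>l\<close>, \<open>l + 1\<close>,
      \<open>l + 2\<close>.\<close>
    have rj: "r + j = Suc (2 * l)"
      using r unfolding j_def k l by auto
    let ?G = "bpoly p r j"
    have "L (Suc (Suc r)) - 2 * L (Suc r) + L r
       = coeff (bpoly p (r + 2) j - smult 2 (bpoly p (r + 1) (j + 1)) + bpoly p r (j + 2)) (n + 1)"
      unfolding L_def j by simp
    also have "\<dots> = (2 * p - 1)\<^sup>2 * coeff ([:1, - 1:] * ([:1, - 1:] * ?G)) (Suc (Suc l))"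
      unfolding bpoly_second_difference l by simp
    also have "\<dots> = (2 * p - 1)\<^sup>2 * (coeff ?G (l + 2) - 2 * coeff ?G (l + 1) + coeff ?G l)"
      by (simp only: coeff_linear_mult) simp
    also have "\<dots> \<le> 0"
      using coeff_bpoly_concave_middle[OF rj p] small unfolding l
      by (intro mult_nonneg_nonpos) auto
    finally show ?thesis .
  qed
  from discrete_concave_above_chord[of k L, OF this i] k show ?thesis
    unfolding L_def by simp
qed

text \<open>Apart from \<open>(x * (1 - x)) ^ (n - 1)\<close> the derivative is a quadratic with
  root \<open>r\<close>, by \<open>root\<close>. Its other root \<open>1 - n - r\<close> is not
  positive, so on the unit interval the sign changes only at \<open>r\<close>, from plus to
  minus.\<close>

lemma product_power_maximal:
  fixes p r :: real
  assumes n: "0 < n" and r: "0 \<le> r" "r \<le> 1"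
    and root: "r\<^sup>2 + (real n - 1) * r = (real n)\<^sup>2 / (2 * real n + 1)"
    and p: "0 \<le> p" "p \<le> 1"
  shows "(p * (1 - p)) ^ n * (real n + p) \<le> (r * (1 - r)) ^ n * (real n + r)"
proof -
  define g where "g x = (x * (1 - x)) ^ n * (real n + x)" for x :: real
  define g' where "g' x = (x * (1 - x)) ^ (n - 1) * ((2 * real n + 1) * (r - x) * (r + x + (real n - 1)))"
    for x :: real
  obtain l where l: "n = Suc l"
    using n by (cases n) auto
  have deriv: "(g has_real_derivative g' x) (at x)" for x
  proof -
    have "(2 * real n + 1) * (r - x) * (r + x + (real n - 1))
        = (2 * real n + 1) * (r\<^sup>2 + (real n - 1) * r) - (2 * real n + 1) * (x\<^sup>2 + (real n - 1) * x)"
      by (simp add: algebra_simps power2_eq_square)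
    also have "\<dots> = (real n)\<^sup>2 - (2 * real n + 1) * (x\<^sup>2 + (real n - 1) * x)"
      unfolding root by simp
    also have "\<dots> = real n * (1 - 2 * x) * (real n + x) + x * (1 - x)"
      by (simp add: algebra_simps power2_eq_square)
    finally have eq: "g' x = (x * (1 - x)) ^ l * (real n * (1 - 2 * x) * (real n + x) + x * (1 - x))"
      by (simp add: g'_def l)
    show ?thesis
      unfolding eq g_def l
      by (rule derivative_eq_intros refl | simp)+ (simp add: algebra_simps)
  qed
  have sum_nonneg: "0 \<le> r + x + (real n - 1)" if "0 \<le> x" for x
    using r n that by simp
  have base: "0 \<le> (x * (1 - x)) ^ (n - 1)" if "0 \<le> x" "x \<le> 1" for x :: real
    using that by simp
  have "g p \<le> g r"
  proof (cases "p \<le> r")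
    case True
    show ?thesis
    proof (rule DERIV_nonneg_imp_nondecreasing[OF True])
      fix x assume x: "p \<le> x" "x \<le> r"
      have "0 \<le> g' x"
        unfolding g'_def using x p r base[of x] sum_nonneg[of x]
        by (intro mult_nonneg_nonneg) auto
      then show "\<exists>y. (g has_real_derivative y) (at x) \<and> 0 \<le> y"
        using deriv by blast
    qed
  next
    case False
    then have "r \<le> p" by simp
    then show ?thesis
    proof (rule DERIV_nonpos_imp_nonincreasing)
      fix x assume x: "r \<le> x" "x \<le> p"
      have "g' x \<le> 0"
        unfolding g'_def using x p r base[of x] sum_nonneg[of x]
        by (intro mult_nonneg_nonpos mult_nonpos_nonneg) auto
      then show "\<exists>y. (g has_real_derivative y) (at x) \<and> y \<le> 0"
        using deriv by blast
    qed
  qed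
  then show ?thesis
    by (simp add: g_def)
qed

text \<open>The radicand is \<open>(k * (k - 1))\<^sup>2 + 4 * k\<close>, so its square root barely
  exceeds \<open>k * (k - 1)\<close>; this places \<open>p\<close> just above \<open>1 / 2\<close>.
  The quadratic is the critical point equation of \<open>product_power_maximal\<close> with
  \<open>n = (k - 1) / 2\<close>.\<close>

lemma optimal_bias:
  fixes k :: real
  assumes k: "3 \<le> k" and p: "p = (3 * k - k\<^sup>2 + sqrt (4 * k + k\<^sup>2 - 2 * k ^ 3 + k ^ 4)) / (4 * k)"
  shows "p\<^sup>2 + ((k - 1) / 2 - 1) * p = ((k - 1) / 2)\<^sup>2 / k"
    and "1 / 2 \<le> p" and "2 * p - 1 \<le> 1 / (k * (k - 1))" and "p < 1"
proof -
  define s where "s = sqrt (4 * k + k\<^sup>2 - 2 * k ^ 3 + k ^ 4)"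
  have radicand: "4 * k + k\<^sup>2 - 2 * k ^ 3 + k ^ 4 = (k * (k - 1))\<^sup>2 + 4 * k"
    by (simp add: algebra_simps power2_eq_square power3_eq_cube power4_eq_xxxx)
  have s2: "s\<^sup>2 = (k * (k - 1))\<^sup>2 + 4 * k"
    unfolding s_def radicand using k by (intro real_sqrt_pow2 add_nonneg_nonneg) auto
  have ps: "4 * k * p = 3 * k - k\<^sup>2 + s"
    using k p by (simp add: s_def)
  have "(4 * k * p + k\<^sup>2 - 3 * k)\<^sup>2 = (k * (k - 1))\<^sup>2 + 4 * k"
    using ps s2 by simp
  then have "16 * k * (k * (p\<^sup>2 + ((k - 1) / 2 - 1) * p) - ((k - 1) / 2)\<^sup>2) = 0"
    by (simp add: field_simps power2_eq_square)
  then have "k * (p\<^sup>2 + ((k - 1) / 2 - 1) * p) = ((k - 1) / 2)\<^sup>2"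
    using k by simp
  then show "p\<^sup>2 + ((k - 1) / 2 - 1) * p = ((k - 1) / 2)\<^sup>2 / k"
    using k by (simp add: field_simps)
  have "k * (k - 1) \<le> s"
    unfolding s_def radicand using k by (intro real_le_rsqrt) simp
  then have "2 * k \<le> 4 * k * p"
    unfolding ps by (simp add: algebra_simps power2_eq_square)
  then show "1 / 2 \<le> p"
    using k by simp
  \<comment> \<open>The correction \<open>2 / (k - 1)\<close> is chosen so that the cross term of
    the square equals \<open>4 * k\<close>.\<close>
  have "2 * (k * (k - 1)) * (2 / (k - 1)) = 4 * k"
    using k by (simp add: field_simps)
  then have "(k * (k - 1))\<^sup>2 + 4 * k \<le> (k * (k - 1) + 2 / (k - 1))\<^sup>2"
    by (simp add: power2_sum)
  then have "s \<le> k * (k - 1) + 2 / (k - 1)"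
    unfolding s_def radicand using k by (intro real_le_lsqrt) auto
  then have "2 * k * (2 * p - 1) \<le> 2 / (k - 1)"
    using ps by (simp add: algebra_simps power2_eq_square)
  then show le: "2 * p - 1 \<le> 1 / (k * (k - 1))"
    using k by (simp add: field_simps)
  have "1 * 1 < k * (k - 1)"
    using k by (intro mult_strict_mono) auto
  then have "1 / (k * (k - 1)) < 1"
    by simp
  then show "p < 1"
    using le by simp
qed

text \<open>At the largest admissible \<open>d\<close> both summands decrease in \<open>n\<close>;
  for \<open>n = 1\<close> they add up to \<open>3 / 2\<close>.\<close>

lemma optimal_bias_small:
  fixes n d :: real
  assumes n: "1 \<le> n" and d: "0 \<le> d" "d \<le> 1 / ((2 * n + 1) * (2 * n))"
  shows "8 * n * d + (4 * n + 2) * d\<^sup>2 \<le> 2"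
proof -
  let ?t = "1 / ((2 * n + 1) * (2 * n))"
  have "8 * n * d + (4 * n + 2) * d\<^sup>2 \<le> 8 * n * ?t + (4 * n + 2) * ?t\<^sup>2"
    using n d by (intro add_mono mult_left_mono power_mono) auto
  also have "\<dots> = 4 / (2 * n + 1) + (1 / (2 * n)) * ((1 / n) * (1 / (2 * n + 1)))"
    using n by (simp add: divide_simps power2_eq_square) (simp add: algebra_simps)?
  also have "\<dots> \<le> 4 / 3 + (1 / 2) * (1 * (1 / 3))"
    using n by (intro add_mono mult_mono divide_left_mono) (auto simp: field_simps)
  finally show ?thesis by simp
qed

subsection \<open>The functionals of symmetric distributions\<close>

lemma pmf_Bern:
  assumes "0 \<le> p" "p \<le> 1"
  shows "pmf (Bern p) 1 = p" and "pmf (Bern p) (- 1) = 1 - p"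
proof -
  let ?f = "\<lambda>b. if b then 1 else - 1 :: int"
  have "inj ?f"
    by (auto simp: inj_def)
  then have "pmf (Bern p) (?f b) = pmf (bernoulli_pmf p) b" for b
    unfolding Bern_def by (rule pmf_map_inj')
  from this[of True] this[of False] assms
  show "pmf (Bern p) 1 = p" and "pmf (Bern p) (- 1) = 1 - p"
    by auto
qed

lemma set_Bern: "set_pmf (Bern p) \<subseteq> {- 1, 1}"
  by (auto simp: Bern_def)

lemma finite_set_Pi_Bern:
  "finite I \<Longrightarrow> finite (set_pmf (Pi_pmf I dflt (\<lambda>_. Bern p)))"
  by (auto simp: set_Pi_pmf intro!: finite_PiE_dflt finite_subset[OF set_Bern])

text \<open>Conditioning on one coordinate multiplies the generating polynomial by a linear factor:
  that coordinate adds 1 to the count with probability \<open>p\<close> if \<open>s i = 1\<close>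
  and \<open>1 - p\<close> otherwise.\<close>

lemma expectation_Pi_Bern_agreements:
  fixes s :: "'a \<Rightarrow> int"
  assumes p: "0 \<le> p" "p \<le> 1" and "finite I" and "\<And>i. i \<in> I \<Longrightarrow> s i \<in> {- 1, 1}"
  shows "measure_pmf.expectation (Pi_pmf I dflt (\<lambda>_. Bern p))
      (\<lambda>b. of_bool (card {i \<in> I. s i * b i = 1} = m))
    = coeff (\<Prod>i\<in>I. if s i = 1 then [:1 - p, p:] else [:p, 1 - p:]) m"
  using assms(3,4)
proof (induction I arbitrary: m rule: finite_induct)
  case empty
  then show ?case by (cases m) auto
next
  case (insert x I)
  let ?Pi = "Pi_pmf I dflt (\<lambda>_. Bern p)"
  let ?P = "\<Prod>i\<in>I. if s i = 1 then [:1 - p, p:] else [:p, 1 - p:]"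
  let ?h = "\<lambda>b. of_bool (card {i \<in> insert x I. s i * b i = 1} = m) :: real"
  define E where "E y = measure_pmf.expectation ?Pi (\<lambda>b. ?h (b(x := y)))" for y
  have sx: "s x = 1 \<or> s x = - 1"
    using insert.prems by auto
  have IH: "measure_pmf.expectation ?Pi (\<lambda>b. of_bool (card {i \<in> I. s i * b i = 1} = j))
      = coeff ?P j" for j
    using insert by auto
  have card: "card {i \<in> insert x I. s i * (b(x := y)) i = 1}
      = card {i \<in> I. s i * b i = 1} + (if s x * y = 1 then 1 else 0)" for b y
  proof -
    have "{i \<in> insert x I. s i * (b(x := y)) i = 1}
        = (if s x * y = 1 then insert x {i \<in> I. s i * b i = 1} else {i \<in> I. s i * b i = 1})"
      using insert.hyps by auto
    then show ?thesis
      using insert.hyps by simp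
  qed
  \<comment> \<open>If the new coordinate counts, the others must supply \<open>m - 1\<close>, which
    is impossible for \<open>m = 0\<close>.\<close>
  have E: "E y = (if s x * y = 1 then (case m of 0 \<Rightarrow> 0 | Suc j \<Rightarrow> coeff ?P j) else coeff ?P m)" for y
    unfolding E_def card IH[symmetric] by (cases m) auto
  have "measure_pmf.expectation (Pi_pmf (insert x I) dflt (\<lambda>_. Bern p)) ?h
      = measure_pmf.expectation (Bern p \<bind> (\<lambda>y. map_pmf (\<lambda>b. b(x := y)) ?Pi)) ?h"
    using insert.hyps by (simp add: Pi_pmf_insert' map_pmf_def)
  also have "\<dots> = (\<Sum>y\<in>{- 1, 1}. pmf (Bern p) y *\<^sub>R E y)"
    unfolding E_def
    using pmf_expectation_bind[of "{- 1, 1}" "\<lambda>y. map_pmf (\<lambda>b. b(x := y)) ?Pi" "Bern p" ?h]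
      finite_set_Pi_Bern[OF insert.hyps(1)] set_Bern[of p]
    by (simp only: set_map_pmf integral_map_pmf finite_imageI finite.intros simp_thms)
  also have "\<dots> = (1 - p) * E (- 1) + p * E 1"
    using p by (simp add: pmf_Bern)
  also have "\<dots> = coeff ((if s x = 1 then [:1 - p, p:] else [:p, 1 - p:]) * ?P) m"
    using sx unfolding E
    by (cases m) (auto simp: coeff_linear_mult simp del: mult_pCons_left)
  finally show ?case
    using insert.hyps by simp
qed

lemma finite_cube: "finite (cube k)"
  unfolding cube_def by (intro finite_PiE) auto

lemma cube_values: "a \<in> cube k \<Longrightarrow> i \<in> {1..k} \<Longrightarrow> a i \<in> {- 1, 1}"
  unfolding cube_def by (rule PiE_mem)

lemma wt_le: "wt k a \<le> k"
proof -
  have "card {i \<in> {1..k}. a i = 1} \<le> card {1..k}"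
    by (intro card_mono) auto
  then show ?thesis
    by (simp add: wt_def)
qed

lemma expectation_sym_fun_Bern_power:
  assumes "0 \<le> p" "p \<le> 1" "a \<in> cube k"
  shows "measure_pmf.expectation (Bern_power k p) (\<lambda>b. sym_fun {m} k (cw_prod k a b))
    = coeff (bpoly p (wt k a) (k - wt k a)) m"
proof -
  have "(\<lambda>b. sym_fun {m} k (cw_prod k a b))
      = (\<lambda>b. of_bool (card {i \<in> {1..k}. a i * b i = 1} = m))"
    unfolding sym_fun_def wt_def cw_prod_def by (auto intro!: ext arg_cong[where f = card])
  moreover have "card ({1..k} \<inter> - {i. a i = 1}) = k - wt k a"
  proof -
    have "{1..k} \<inter> - {i. a i = 1} = {1..k} - {i \<in> {1..k}. a i = 1}"
      by auto
    moreover have "card ({1..k} - {i \<in> {1..k}. a i = 1}) = card {1..k} - wt k a"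
      unfolding wt_def by (intro card_Diff_subset) auto
    ultimately show ?thesis
      by simp
  qed
  moreover have "{1..k} \<inter> {i. a i = 1} = {i \<in> {1..k}. a i = 1}"
    by auto
  ultimately show ?thesis
    using expectation_Pi_Bern_agreements[of p "{1..k}" a undefined m] assms cube_values[of a k]
    by (simp add: Bern_power_def bpoly_def prod.If_cases wt_def)
qed

lemma sym_distsD:
  assumes "D \<in> sym_dists k"
  shows "set_pmf D \<subseteq> cube k" and "finite (set_pmf D)"
    and "x \<in> cube k \<Longrightarrow> y \<in> cube k \<Longrightarrow> wt k x = wt k y \<Longrightarrow> pmf D x = pmf D y"
proof -
  show sub: "set_pmf D \<subseteq> cube k"
    using assms by (simp add: sym_dists_def)
  show "finite (set_pmf D)"
    by (rule finite_subset[OF sub finite_cube])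
  show "x \<in> cube k \<Longrightarrow> y \<in> cube k \<Longrightarrow> wt k x = wt k y \<Longrightarrow> pmf D x = pmf D y"
    using assms unfolding sym_dists_def by blast
qed

lemma expectation_sym_dists:
  fixes f :: "(nat \<Rightarrow> int) \<Rightarrow> real"
  assumes "D \<in> sym_dists k"
  shows "measure_pmf.expectation D f = (\<Sum>a\<in>cube k. f a * pmf D a)"
  using sym_distsD(1)[OF assms] by (intro integral_measure_pmf_real finite_cube) auto

text \<open>Averaging over the Bernoulli vector first leaves a function of the weight of
  \<open>a\<close> alone.\<close>

lemma lam_eq_expectation:
  assumes D: "D \<in> sym_dists k" and p: "0 \<le> p" "p \<le> 1"
  shows "lam {m} k D p
    = measure_pmf.expectation D (\<lambda>a. coeff (bpoly p (wt k a) (k - wt k a)) m)"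
proof -
  have pair: "pair_pmf D (Bern_power k p) = D \<bind> (\<lambda>a. map_pmf (Pair a) (Bern_power k p))"
    by (simp add: pair_pmf_def map_pmf_def)
  have "lam {m} k D p = (\<Sum>a\<in>cube k. pmf D a *\<^sub>R
      measure_pmf.expectation (Bern_power k p) (\<lambda>b. sym_fun {m} k (cw_prod k a b)))"
    unfolding lam_def pair
    by (subst pmf_expectation_bind[of "cube k"])
      (use sym_distsD(1)[OF D] finite_cube in \<open>auto simp: Bern_power_def finite_set_Pi_Bern\<close>)
  also have "\<dots> = (\<Sum>a\<in>cube k. coeff (bpoly p (wt k a) (k - wt k a)) m * pmf D a)"
    using p by (intro sum.cong) (auto simp: expectation_sym_fun_Bern_power)
  finally show ?thesis
    unfolding expectation_sym_dists[OF D] .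
qed

text \<open>Provides the boundedness that the real supremum in \<open>beta\<close> requires.\<close>

lemma lam_le_1: "lam S k D p \<le> 1"
  unfolding lam_def
  by (intro measure_pmf.integral_le_const measure_pmf.integrable_const_bound[where B = 1])
    (auto simp: sym_fun_def)

lemma lam_le_beta:
  assumes "0 \<le> p" "p \<le> 1"
  shows "lam S k D p \<le> beta S k D"
  unfolding beta_def using assms lam_le_1 by (intro cSUP_upper bdd_aboveI2) auto

lemma gamma_eq_expectation:
  assumes "D \<in> sym_dists k"
  shows "gamma {m} k D = measure_pmf.expectation D (\<lambda>a. of_bool (wt k a = m))"
proof -
  \<comment> \<open>At bias 1 the second vector is constantly 1, and the generating polynomial
    collapses to a monomial.\<close>
  have "coeff (bpoly 1 w j) m = of_bool (w = m)" for w j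
  proof -
    have "bpoly 1 w j = [:0, 1:] ^ w"
      by (simp add: bpoly_def flip: one_pCons)
    then show ?thesis
      using coeff_linear_power[of 0 1 w m] by (auto simp: binomial_eq_0)
  qed
  then show ?thesis
    unfolding gamma_def lam_eq_expectation[OF assms zero_le_one order_refl] by simp
qed

section \<open>Coordinate symmetry and the mean weight\<close>

lemma comp_transpose_in_cube:
  assumes "x \<in> cube k" "i \<in> {1..k}" "j \<in> {1..k}"
  shows "x \<circ> Transposition.transpose i j \<in> cube k"
  using assms unfolding cube_def PiE_iff extensional_def
  by (auto simp: Transposition.transpose_def)

lemma wt_comp_transpose:
  assumes "i \<in> {1..k}" "j \<in> {1..k}"
  shows "wt k (x \<circ> Transposition.transpose i j) = wt k x"
proof -
  have "Transposition.transpose i j ` {l \<in> {1..k}. x l = 1} = {l \<in> {1..k}. (x \<circ> Transposition.transpose i j) l = 1}"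
  proof (intro equalityI subsetI)
    fix l assume l: "l \<in> {l \<in> {1..k}. (x \<circ> Transposition.transpose i j) l = 1}"
    then have "Transposition.transpose i j l \<in> {l \<in> {1..k}. x l = 1}"
      using assms by (auto simp: Transposition.transpose_def)
    then show "l \<in> Transposition.transpose i j ` {l \<in> {1..k}. x l = 1}"
      by (metis image_eqI transpose_involutory)
  qed (use assms in \<open>auto simp: Transposition.transpose_def\<close>)
  then show ?thesis
    unfolding wt_def using card_image[OF inj_on_transpose, of i j "{l \<in> {1..k}. x l = 1}"]
    by (simp only:)
qed

text \<open>Swapping coordinates \<open>1\<close> and \<open>i\<close> preserves the weight, hence
  the probability of each vector.\<close>

lemma expectation_coordinate:
  assumes D: "D \<in> sym_dists k" and i: "i \<in> {1..k}"
  shows "measure_pmf.expectation D (\<lambda>b. real_of_int (b i)) = mu D"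
proof -
  have one: "1 \<in> {1..k}"
    using i by auto
  have closed: "a \<circ> Transposition.transpose 1 i \<in> cube k" if "a \<in> cube k" for a
    using that one i by (rule comp_transpose_in_cube)
  have "(\<Sum>a\<in>cube k. real_of_int (a i) * pmf D a) = (\<Sum>a\<in>cube k. real_of_int (a 1) * pmf D a)"
  proof (rule sum.reindex_bij_witness[of _ "\<lambda>x. x \<circ> Transposition.transpose 1 i" "\<lambda>x. x \<circ> Transposition.transpose 1 i"])
    fix a assume a: "a \<in> cube k"
    have "pmf D (a \<circ> Transposition.transpose 1 i) = pmf D a"
      using a by (intro sym_distsD(3)[OF D] closed wt_comp_transpose one i)
    then show "real_of_int ((a \<circ> Transposition.transpose 1 i) 1) * pmf D (a \<circ> Transposition.transpose 1 i)
        = real_of_int (a i) * pmf D a"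
      by simp
  qed (use closed in \<open>auto simp: comp_assoc\<close>)
  then show ?thesis
    unfolding mu_def expectation_sym_dists[OF D] .
qed

text \<open>All coordinates have mean \<open>mu D\<close>, and the coordinates of a vector sum to
  twice its weight minus \<open>k\<close>.\<close>

lemma mu_eq_expectation_wt:
  assumes D: "D \<in> sym_dists k" and k: "0 < k"
  shows "real k * mu D = 2 * measure_pmf.expectation D (\<lambda>a. real (wt k a)) - real k"
proof -
  note int = integrable_measure_pmf_finite[OF sym_distsD(2)[OF D]]
  have coords: "(\<Sum>i\<in>{1..k}. real_of_int (a i)) = 2 * real (wt k a) - real k" if "a \<in> cube k" for a
  proof -
    have "(\<Sum>i\<in>{1..k}. real_of_int (a i)) = (\<Sum>i\<in>{1..k}. 2 * of_bool (a i = 1) - 1)"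
      using cube_values[OF that] by (intro sum.cong) force+
    also have "\<dots> = 2 * (\<Sum>i\<in>{1..k}. of_bool (a i = 1)) - real k"
      by (simp add: sum_subtractf sum_distrib_left)
    also have "(\<Sum>i\<in>{1..k}. of_bool (a i = 1)) = real (wt k a)"
      by (simp add: wt_def sum.inter_filter[symmetric] of_bool_def)
    finally show ?thesis .
  qed
  have "real k * mu D = (\<Sum>i\<in>{1..k}. measure_pmf.expectation D (\<lambda>b. real_of_int (b i)))"
    using expectation_coordinate[OF D] by simp
  also have "\<dots> = measure_pmf.expectation D (\<lambda>b. \<Sum>i\<in>{1..k}. real_of_int (b i))"
    using int by (intro Bochner_Integration.integral_sum[symmetric])
  also have "\<dots> = measure_pmf.expectation D (\<lambda>a. 2 * real (wt k a) - real k)"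
    using sym_distsD(1)[OF D] coords by (intro integral_cong_AE) (auto simp: AE_measure_pmf_iff)
  also have "\<dots> = 2 * measure_pmf.expectation D (\<lambda>a. real (wt k a)) - real k"
    by (simp only: Bochner_Integration.integral_diff[OF int int] integral_mult_right_zero)
      simp
  finally show ?thesis .
qed

subsection \<open>Extremal distributions and the ratio\<close>

definition level_pmf :: "nat \<Rightarrow> nat \<Rightarrow> (nat \<Rightarrow> int) pmf" where
  "level_pmf k w = pmf_of_set {x \<in> cube k. wt k x = w}"

lemma level_nonempty:
  assumes "w \<le> k"
  shows "{x \<in> cube k. wt k x = w} \<noteq> {}"
proof -
  define x :: "nat \<Rightarrow> int" where "x = (\<lambda>i\<in>{1..k}. if i \<le> w then 1 else - 1)"
  have "x \<in> cube k"
    by (auto simp: x_def cube_def)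
  moreover have "{i \<in> {1..k}. x i = 1} = {1..w}"
    using assms by (auto simp: x_def)
  then have "wt k x = w"
    by (simp add: wt_def)
  ultimately show ?thesis
    by blast
qed

lemma finite_level: "finite {x \<in> cube k. wt k x = w}"
  by (rule finite_subset[OF _ finite_cube[of k]]) auto

lemma set_level_pmf: "w \<le> k \<Longrightarrow> set_pmf (level_pmf k w) = {x \<in> cube k. wt k x = w}"
  unfolding level_pmf_def by (rule set_pmf_of_set[OF level_nonempty finite_level])

lemma level_pmf_in_sym_dists:
  assumes "w \<le> k"
  shows "level_pmf k w \<in> sym_dists k"
  unfolding sym_dists_def mem_Collect_eq set_level_pmf[OF assms]
  by (auto simp: level_pmf_def pmf_of_set[OF level_nonempty[OF assms] finite_level] indicator_def)

lemma expectation_level_pmf: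
  fixes f :: "nat \<Rightarrow> real"
  assumes "w \<le> k"
  shows "measure_pmf.expectation (level_pmf k w) (\<lambda>a. f (wt k a)) = f w"
proof -
  have "measure_pmf.expectation (level_pmf k w) (\<lambda>a. f (wt k a))
      = measure_pmf.expectation (level_pmf k w) (\<lambda>_. f w)"
    by (intro integral_cong_AE) (auto simp: AE_measure_pmf_iff set_level_pmf[OF assms])
  then show ?thesis
    by simp
qed

text \<open>The levels \<open>k\<close> and \<open>0\<close> contain only the two constant vectors;
  phrasing the mixture through \<open>level_pmf\<close> lets it inherit symmetry.\<close>

definition extreme_pmf :: "nat \<Rightarrow> real \<Rightarrow> (nat \<Rightarrow> int) pmf" where
  "extreme_pmf k r = bernoulli_pmf r \<bind> (\<lambda>b. level_pmf k (if b then k else 0))"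

lemma extreme_pmf_in_sym_dists: "extreme_pmf k r \<in> sym_dists k"
proof -
  have level: "level_pmf k (if b then k else 0) \<in> sym_dists k" for b
    by (rule level_pmf_in_sym_dists) simp
  have "set_pmf (extreme_pmf k r) \<subseteq> cube k"
    unfolding extreme_pmf_def set_bind_pmf by (intro UN_least sym_distsD(1)[OF level])
  moreover have "pmf (extreme_pmf k r) x = pmf (extreme_pmf k r) y"
    if "x \<in> cube k" "y \<in> cube k" "wt k x = wt k y" for x y
    unfolding extreme_pmf_def pmf_bind sym_distsD(3)[OF level that] ..
  ultimately show ?thesis
    unfolding sym_dists_def by blast
qed

lemma expectation_extreme_pmf:
  fixes f :: "nat \<Rightarrow> real"
  assumes "0 \<le> r" "r \<le> 1"
  shows "measure_pmf.expectation (extreme_pmf k r) (\<lambda>a. f (wt k a)) = r * f k + (1 - r) * f 0"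
proof -
  have "finite (set_pmf (level_pmf k (if b then k else 0)))" for b
    by (intro sym_distsD(2)[of _ k] level_pmf_in_sym_dists) simp
  then have "measure_pmf.expectation (extreme_pmf k r) (\<lambda>a. f (wt k a))
      = (\<Sum>b\<in>UNIV. pmf (bernoulli_pmf r) b *\<^sub>R
          measure_pmf.expectation (level_pmf k (if b then k else 0)) (\<lambda>a. f (wt k a)))"
    unfolding extreme_pmf_def by (intro pmf_expectation_bind) simp_all
  then show ?thesis
    using assms by (simp add: UNIV_bool expectation_level_pmf)
qed

lemma coeff_bpoly_extreme:
  assumes "k = 2 * n + 1"
  shows "coeff (bpoly p 0 k) (n + 1) = real (k choose (n + 1)) * (1 - p) ^ (n + 1) * p ^ n"
    and "coeff (bpoly p k 0) (n + 1) = real (k choose (n + 1)) * (1 - p) ^ n * p ^ (n + 1)"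
proof -
  have "k - (n + 1) = n"
    using assms by simp
  then show "coeff (bpoly p 0 k) (n + 1) = real (k choose (n + 1)) * (1 - p) ^ (n + 1) * p ^ n"
    and "coeff (bpoly p k 0) (n + 1) = real (k choose (n + 1)) * (1 - p) ^ n * p ^ (n + 1)"
    unfolding bpoly_def power_0 mult_1_left mult_1_right coeff_linear_power by (simp_all only: mult_ac)
qed

text \<open>The value of \<^const>\<open>lam\<close> at \<open>p\<close> for the mixture of the two constant vectors with mean \<open>1 / k\<close>.\<close>

definition extreme_value :: "nat \<Rightarrow> real \<Rightarrow> real" where
  "extreme_value n p = (let k = 2 * n + 1 in real n / real k * coeff (bpoly p 0 k) (n + 1)
     + real (n + 1) / real k * coeff (bpoly p k 0) (n + 1))"

text \<open>Factoring out \<open>(p * (1 - p)) ^ n\<close> leaves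
  \<open>n * (1 - p) + (n + 1) * p = n + p\<close>, which is the function maximised in
  \<open>product_power_maximal\<close>.\<close>

lemma extreme_value_eq:
  "extreme_value n p = real (2 * n + 1 choose (n + 1)) / real (2 * n + 1) * ((p * (1 - p)) ^ n * (real n + p))"
proof -
  have "m / K * (c * (Q * (1 - p)) * P) + (1 + m) / K * (c * Q * (P * p)) = c / K * (P * Q * (m + p))"
    if "K \<noteq> 0" for m K c P Q :: real
    using that by (simp add: field_simps)
  from this[of "real (2 * n + 1)" "real n" "real (2 * n + 1 choose (n + 1))" "(1 - p) ^ n" "p ^ n"]
  show ?thesis
    unfolding extreme_value_def Let_def coeff_bpoly_extreme[OF refl] power_mult_distrib power_add
    by simp
qed

lemma beta_extreme_pmf_le:
  assumes n: "0 < n" and k: "k = 2 * n + 1" and r: "0 \<le> r" "r \<le> 1"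
    and root: "r\<^sup>2 + (real n - 1) * r = (real n)\<^sup>2 / (2 * real n + 1)"
  shows "beta {n + 1} k (extreme_pmf k (real (n + 1) / real k)) \<le> extreme_value n r"
  unfolding beta_def
proof (rule cSUP_least)
  fix p :: real assume p: "p \<in> {0..1}"
  have q: "1 - real (n + 1) / real k = real n / real k"
    using k by (simp add: field_simps)
  have r01: "0 \<le> real (n + 1) / real k" "real (n + 1) / real k \<le> 1"
    using k by simp_all
  have "lam {n + 1} k (extreme_pmf k (real (n + 1) / real k)) p
      = real (n + 1) / real k * coeff (bpoly p k (k - k)) (n + 1)
        + real n / real k * coeff (bpoly p 0 (k - 0)) (n + 1)"
    using p unfolding q[symmetric]
    by (subst lam_eq_expectation[OF extreme_pmf_in_sym_dists])
      (simp_all only: expectation_extreme_pmf[OF r01, where f = "\<lambda>w. coeff (bpoly p w (k - w)) (n + 1)"]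
        atLeastAtMost_iff)
  also have "\<dots> = extreme_value n p"
    unfolding extreme_value_def Let_def k[symmetric] by simp
  also have "\<dots> \<le> extreme_value n r"
    unfolding extreme_value_eq using p
    by (intro mult_left_mono product_power_maximal[OF n r root]) auto
  finally show "lam {n + 1} k (extreme_pmf k (real (n + 1) / real k)) p \<le> extreme_value n r" .
qed simp

text \<open>The chord is affine in the weight, so its expectation depends on \<open>D\<close> only
  through \<open>mu D\<close>.\<close>

lemma beta_ge:
  assumes D: "D \<in> sym_dists k" and p: "1 / 2 \<le> p" "p < 1" and k: "k = 2 * n + 1" and n: "0 < n"
    and small: "8 * real n * (2 * p - 1) + (4 * real n + 2) * (2 * p - 1)\<^sup>2 \<le> 2"
  shows "(1 - mu D) / 2 * coeff (bpoly p 0 k) (n + 1) + (1 + mu D) / 2 * coeff (bpoly p k 0) (n + 1)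
    \<le> beta {n + 1} k D"
proof -
  let ?E = "measure_pmf.expectation D"
  let ?L0 = "coeff (bpoly p 0 k) (n + 1)" and ?Lk = "coeff (bpoly p k 0) (n + 1)"
  note int = integrable_measure_pmf_finite[OF sym_distsD(2)[OF D]]
  have k0: "0 < real k"
    using k by simp
  define W where "W = ?E (\<lambda>a. real (wt k a))"
  have "real k * mu D = 2 * W - real k"
    unfolding W_def using k by (intro mu_eq_expectation_wt[OF D]) simp
  then have mu: "mu D = 2 * (W / real k) - 1"
    using k0 by (simp add: field_simps)
  have "(1 - mu D) / 2 * ?L0 + (1 + mu D) / 2 * ?Lk = ?L0 + (?Lk - ?L0) / real k * W"
    unfolding mu using k0 by (simp add: field_simps)
  also have "\<dots> = ?E (\<lambda>a. ?L0 + (?Lk - ?L0) / real k * real (wt k a))"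
    unfolding W_def by (simp add: Bochner_Integration.integral_add[OF int int])
  also have "\<dots> \<le> ?E (\<lambda>a. coeff (bpoly p (wt k a) (k - wt k a)) (n + 1))"
  proof (intro integral_mono int)
    fix a
    have "?L0 + (?Lk - ?L0) / real k * real (wt k a)
        = (real k - real (wt k a)) / real k * ?L0 + real (wt k a) / real k * ?Lk"
      using k0 by (simp add: field_simps)
    then show "?L0 + (?Lk - ?L0) / real k * real (wt k a) \<le> coeff (bpoly p (wt k a) (k - wt k a)) (n + 1)"
      using coeff_bpoly_above_chord[OF p wt_le k n small] by simp
  qed
  also have "\<dots> = lam {n + 1} k D p"
    using p by (intro lam_eq_expectation[OF D, symmetric]) auto
  also have "\<dots> \<le> beta {n + 1} k D"
    using p by (intro lam_le_beta) auto
  finally show ?thesis .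
qed

text \<open>Markov-type bounds: the indicator of weight \<open>n + 1\<close>, scaled by
  \<open>n + 1\<close> or by \<open>n\<close>, lies pointwise below the weight or its complement in
  \<open>k\<close>. Both are tight on that level.\<close>

lemma gamma_bounds:
  assumes D: "D \<in> sym_dists k" and k: "k = 2 * n + 1"
  shows "0 \<le> gamma {n + 1} k D"
    and "real (n + 1) / real k * gamma {n + 1} k D \<le> (1 + mu D) / 2"
    and "real n / real k * gamma {n + 1} k D \<le> (1 - mu D) / 2"
proof -
  let ?E = "measure_pmf.expectation D"
  note int = integrable_measure_pmf_finite[OF sym_distsD(2)[OF D]]
  note gamma = gamma_eq_expectation[OF D, of "n + 1"]
  have kmu: "real k * mu D = 2 * ?E (\<lambda>a. real (wt k a)) - real k"
    using k by (intro mu_eq_expectation_wt[OF D]) simp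
  show "0 \<le> gamma {n + 1} k D"
    unfolding gamma by (intro integral_nonneg_AE) simp
  have "real (n + 1) * gamma {n + 1} k D = ?E (\<lambda>a. real (n + 1) * of_bool (wt k a = n + 1))"
    unfolding gamma by simp
  also have "\<dots> \<le> ?E (\<lambda>a. real (wt k a))"
    by (intro integral_mono int) auto
  finally show "real (n + 1) / real k * gamma {n + 1} k D \<le> (1 + mu D) / 2"
    using kmu k by (simp add: field_simps)
  have "real n * gamma {n + 1} k D = ?E (\<lambda>a. real n * of_bool (wt k a = n + 1))"
    unfolding gamma by simp
  also have "\<dots> \<le> ?E (\<lambda>a. real k - real (wt k a))"
  proof (intro integral_mono int)
    fix a
    have "real (wt k a) \<le> real k"
      using wt_le by simp
    then show "real n * of_bool (wt k a = n + 1) \<le> real k - real (wt k a)"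
      using k by (cases "wt k a = n + 1") simp_all
  qed
  also have "\<dots> = real k - ?E (\<lambda>a. real (wt k a))"
    by (simp add: Bochner_Integration.integral_diff[OF int int])
  finally show "real n / real k * gamma {n + 1} k D \<le> (1 - mu D) / 2"
    using kmu k by (simp add: field_simps)
qed

lemma alpha_middle_level:
  assumes k: "k = 2 * n + 1" and n: "0 < n" and p: "1 / 2 \<le> p" "p < 1"
    and small: "8 * real n * (2 * p - 1) + (4 * real n + 2) * (2 * p - 1)\<^sup>2 \<le> 2"
    and root: "p\<^sup>2 + (real n - 1) * p = (real n)\<^sup>2 / (2 * real n + 1)"
  shows "alpha {n + 1} k = ereal (extreme_value n p)"
proof (rule antisym)
  let ?DN = "extreme_pmf k (real (n + 1) / real k)" and ?DY = "level_pmf k (n + 1)"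
  have le: "n + 1 \<le> k" and k0: "0 < k"
    using k by auto
  note N = extreme_pmf_in_sym_dists[of k "real (n + 1) / real k"]
    and Y = level_pmf_in_sym_dists[OF le]
  \<comment> \<open>Both distributions have expected weight \<open>n + 1\<close>.\<close>
  have "real k * mu ?DN = real k * mu ?DY"
    unfolding mu_eq_expectation_wt[OF N k0] mu_eq_expectation_wt[OF Y k0]
    using le k0 by (simp add: expectation_extreme_pmf[where f = real] expectation_level_pmf[where f = real])
  then have mu: "mu ?DN = mu ?DY"
    using k0 by simp
  have gamma: "gamma {n + 1} k ?DY = 1"
    unfolding gamma_eq_expectation[OF Y]
      expectation_level_pmf[OF le, where f = "\<lambda>w. of_bool (w = n + 1)"] by simp
  have "alpha {n + 1} k \<le> ereal (beta {n + 1} k ?DN)"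
    unfolding alpha_def using N Y mu gamma by (intro INF_lower2[of "(?DN, ?DY)"]) auto
  also have "\<dots> \<le> ereal (extreme_value n p)"
    using beta_extreme_pmf_le[OF n k _ _ root] p by simp
  finally show "alpha {n + 1} k \<le> ereal (extreme_value n p)" .
next
  let ?L0 = "coeff (bpoly p 0 k) (n + 1)" and ?Lk = "coeff (bpoly p k 0) (n + 1)"
  have nonneg: "0 \<le> ?L0" "0 \<le> ?Lk"
    using p by (auto intro!: coeff_bpoly_nonneg)
  have "ereal (extreme_value n p) \<le> ereal (beta {n + 1} k DN / gamma {n + 1} k DY)"
    if N: "DN \<in> sym_dists k" and Y: "DY \<in> sym_dists k" and mu: "mu DN = mu DY"
      and "gamma {n + 1} k DY \<noteq> 0" for DN DY
  proof -
    let ?g = "gamma {n + 1} k DY"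
    have g: "0 < ?g"
      using gamma_bounds(1)[OF Y k] that by simp
    \<comment> \<open>Each term of the extreme value is weighted by one of the two fractions in
      \<open>gamma_bounds\<close>; the equality of means then carries the bound from
      \<open>DY\<close> to \<open>DN\<close>.\<close>
    have "extreme_value n p * ?g = real n / real k * ?g * ?L0 + real (n + 1) / real k * ?g * ?Lk"
      unfolding extreme_value_def Let_def k[symmetric] by (simp add: algebra_simps)
    also have "\<dots> \<le> (1 - mu DY) / 2 * ?L0 + (1 + mu DY) / 2 * ?Lk"
      using gamma_bounds[OF Y k] nonneg by (intro add_mono mult_right_mono)
    also have "\<dots> \<le> beta {n + 1} k DN"
      using beta_ge[OF N p k n small] unfolding mu .
    finally show ?thesis
      using g by (simp add: pos_le_divide_eq)
  qed
  then show "ereal (extreme_value n p) \<le> alpha {n + 1} k"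
    unfolding alpha_def by (intro INF_greatest) auto
qed

theorem theorem5p11:
  fixes k :: nat and p' :: real
  assumes "odd k" and "3 \<le> k" and "k \<le> 51"
    and "p' = (3 * real k - real k ^ 2
                + sqrt (4 * real k + real k ^ 2 - 2 * real k ^ 3 + real k ^ 4)) / (4 * real k)"
  shows "alpha {(k + 1) div 2} k = ereal (
    real (k choose ((k + 1) div 2)) *
      ((real k - 1) / (2 * real k) * (1 - p') ^ ((k + 1) div 2) * p' ^ ((k - 1) div 2)
       + (real k + 1) / (2 * real k) * (1 - p') ^ ((k - 1) div 2) * p' ^ ((k + 1) div 2)))"
proof -
  obtain n where k: "k = 2 * n + 1"
    using \<open>odd k\<close> by (elim oddE)
  have n: "0 < n"
    using k \<open>3 \<le> k\<close> by simp
  have half: "(real k - 1) / 2 = real n"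
    using k by simp
  have real_k: "real k = 2 * real n + 1"
    using k by simp
  have "3 \<le> real k"
    using \<open>3 \<le> k\<close> by simp
  note bias = optimal_bias[OF this assms(4)]
  have root: "p'\<^sup>2 + (real n - 1) * p' = (real n)\<^sup>2 / (2 * real n + 1)"
    using bias(1) unfolding half unfolding real_k .
  have "2 * p' - 1 \<le> 1 / ((2 * real n + 1) * (2 * real n))"
    using bias(3) unfolding real_k by simp
  then have small: "8 * real n * (2 * p' - 1) + (4 * real n + 2) * (2 * p' - 1)\<^sup>2 \<le> 2"
    using n bias(2) by (intro optimal_bias_small) auto
  have "(k + 1) div 2 = n + 1" "(k - 1) div 2 = n"
    using k by auto
  moreover have "(real k - 1) / (2 * real k) = real n / real k"
    "(real k + 1) / (2 * real k) = real (n + 1) / real k"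
    using k by (simp_all add: field_simps)
  moreover have "extreme_value n p' = real (k choose (n + 1)) *
      (real n / real k * (1 - p') ^ (n + 1) * p' ^ n
       + real (n + 1) / real k * (1 - p') ^ n * p' ^ (n + 1))"
    unfolding extreme_value_def Let_def k[symmetric] coeff_bpoly_extreme[OF k]
    by (simp only: ring_distribs mult_ac)
  ultimately show ?thesis
    using alpha_middle_level[OF k n bias(2,4) small root] by (simp only:)
qed

end
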